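(* (1) For every $n \geq 3$, the natural linear action of the (discrete) group $\mathrm{SL}_n(\mathbb{Z})$ on $\mathbb{R}^n$ is not Asplund representable. (2) For every $n \geq 4$, the conjugation action $(g,x) \mapsto gxg^{-1}$ of $\mathrm{SL}_n(\mathbb{R})$ on itself is not Asplund representable.
   Context: All topological spaces are assumed to be Tychonoff. For a topological group $G$, a $G$-space is a topological space $X$ with a continuous action $G \times X \to X$. For a Banach space $V$, $\mathrm{Iso}(V)$ is the topological group of linear isometries of $V$ onto itself with the strong operator topology; it acts on the dual $V^*$ by $(gu^* )(v) = u^*(g^{-1}v)$. A representation of a $G$-space $X$ on $V$ is a pair $(h,\alpha)$ where $h \colon G \to \mathrm{Iso}(V)$ is a continuous homomorphism and $\alpha \colon X \to V^*$ is a norm-bounded, weak-star continuous map that is equivariant: $\alpha(gx) = h(g)\alpha(x)$ for all $g \in G$, $x \in X$. The representation is proper if $\alpha$ is a topological embedding (with $V^*$ carrying the weak-star topology). A Banach space $V$ is Asplund if the dual $W^*$ of every separable Banach subspace $W$ of $V$ is separable. A $G$-space (or its action) is Asplund representable if it admits a proper representation on some Asplund Banach space $V$. *)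

theory Defs
  imports "HOL-Analysis.Analysis" "HOL-Algebra.Group"
begin

section \<open>Topological groups and \<open>G\<close>-spaces\<close>

definition Tychonoff_space :: "'a topology \<Rightarrow> bool" where
  "Tychonoff_space X \<longleftrightarrow> completely_regular_space X \<and> Hausdorff_space X"

definition topological_group :: "('g, 'm) monoid_scheme \<Rightarrow> 'g topology \<Rightarrow> bool" where
  "topological_group G TG \<longleftrightarrow>
     group G \<and> topspace TG = carrier G \<and> Tychonoff_space TG \<and>
     continuous_map (prod_topology TG TG) TG (\<lambda>(x, y). x \<otimes>\<^bsub>G\<^esub> y) \<and>
     continuous_map TG TG (\<lambda>x. inv\<^bsub>G\<^esub> x)"

definition G_space ::
  "('g, 'm) monoid_scheme \<Rightarrow> 'g topology \<Rightarrow> 'x topology \<Rightarrow> ('g \<Rightarrow> 'x \<Rightarrow> 'x) \<Rightarrow> bool" where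
  "G_space G TG X act \<longleftrightarrow>
     topological_group G TG \<and> Tychonoff_space X \<and>
     continuous_map (prod_topology TG X) X (\<lambda>(g, x). act g x) \<and>
     (\<forall>x\<in>topspace X. act \<one>\<^bsub>G\<^esub> x = x) \<and>
     (\<forall>g\<in>carrier G. \<forall>h\<in>carrier G. \<forall>x\<in>topspace X. act (g \<otimes>\<^bsub>G\<^esub> h) x = act g (act h x))"


section \<open>Representations on Banach spaces\<close>

definition Iso :: "('v::banach \<Rightarrow>\<^sub>L 'v) monoid" where
  "Iso = \<lparr>carrier = {u. (\<forall>v. norm (blinfun_apply u v) = norm v) \<and> surj (blinfun_apply u)},
          mult = (o\<^sub>L), one = id_blinfun\<rparr>"

definition Iso_topology :: "('v::banach \<Rightarrow>\<^sub>L 'v) topology" where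
  "Iso_topology = subtopology strong_operator_topology (carrier Iso)"

text \<open>On \<open>V\<^sup>* = Hom(V, \<real>)\<close> the topology of pointwise convergence, which the library calls the
  strong operator topology, is the weak-star topology.\<close>

definition weak_star_topology :: "('v::banach \<Rightarrow>\<^sub>L real) topology" where
  "weak_star_topology = strong_operator_topology"

definition dual_act :: "('v::banach \<Rightarrow>\<^sub>L 'v) \<Rightarrow> ('v \<Rightarrow>\<^sub>L real) \<Rightarrow> ('v \<Rightarrow>\<^sub>L real)" where
  "dual_act u f = f o\<^sub>L (inv\<^bsub>Iso\<^esub> u)"

definition representation ::
  "('g, 'm) monoid_scheme \<Rightarrow> 'g topology \<Rightarrow> 'x topology \<Rightarrow> ('g \<Rightarrow> 'x \<Rightarrow> 'x) \<Rightarrow>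
   ('g \<Rightarrow> ('v::banach \<Rightarrow>\<^sub>L 'v)) \<Rightarrow> ('x \<Rightarrow> ('v \<Rightarrow>\<^sub>L real)) \<Rightarrow> bool" where
  "representation G TG X act h \<alpha> \<longleftrightarrow>
     h \<in> hom G Iso \<and> continuous_map TG Iso_topology h \<and>
     bounded (\<alpha> ` topspace X) \<and> continuous_map X weak_star_topology \<alpha> \<and>
     (\<forall>g\<in>carrier G. \<forall>x\<in>topspace X. \<alpha> (act g x) = dual_act (h g) (\<alpha> x))"

definition proper_representation ::
  "('g, 'm) monoid_scheme \<Rightarrow> 'g topology \<Rightarrow> 'x topology \<Rightarrow> ('g \<Rightarrow> 'x \<Rightarrow> 'x) \<Rightarrow>
   ('g \<Rightarrow> ('v::banach \<Rightarrow>\<^sub>L 'v)) \<Rightarrow> ('x \<Rightarrow> ('v \<Rightarrow>\<^sub>L real)) \<Rightarrow> bool" where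
  "proper_representation G TG X act h \<alpha> \<longleftrightarrow>
     representation G TG X act h \<alpha> \<and> embedding_map X weak_star_topology \<alpha>"


section \<open>Asplund spaces\<close>

text \<open>A Banach subspace \<open>W\<close> of \<open>V\<close> is a closed linear subset rather than a type, so its dual is the
  set of bounded linear functionals defined on \<open>W\<close> only (extended by \<open>undefined\<close> outside \<open>W\<close>,
  to make equality of functionals agree with equality on \<open>W\<close>), and separability
  is density of a countable set with respect to the dual norm.\<close>

definition subspace_dual :: "'v::real_normed_vector set \<Rightarrow> ('v \<Rightarrow> real) set" where
  "subspace_dual W = {f \<in> extensional W.
     (\<forall>x\<in>W. \<forall>y\<in>W. f (x + y) = f x + f y) \<and>
     (\<forall>c. \<forall>x\<in>W. f (c *\<^sub>R x) = c * f x) \<and>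
     (\<exists>K. \<forall>x\<in>W. \<bar>f x\<bar> \<le> K * norm x)}"

definition dual_norm :: "'v::real_normed_vector set \<Rightarrow> ('v \<Rightarrow> real) \<Rightarrow> real" where
  "dual_norm W f = (SUP x\<in>W \<inter> cball 0 1. \<bar>f x\<bar>)"

definition separable_dual :: "'v::real_normed_vector set \<Rightarrow> bool" where
  "separable_dual W \<longleftrightarrow>
     (\<exists>D \<subseteq> subspace_dual W. countable D \<and>
        (\<forall>f\<in>subspace_dual W. \<forall>e>0. \<exists>d\<in>D. dual_norm W (\<lambda>x. f x - d x) < e))"

definition Asplund_space :: "'v::banach itself \<Rightarrow> bool" where
  "Asplund_space _ \<longleftrightarrow>
     (\<forall>W :: 'v set. subspace W \<and> closed W \<and> separable_space (top_of_set W) \<longrightarrow>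
        separable_dual W)"

text \<open>HOL has no quantifier over types, so the Banach space is a parameter. A \<open>G\<close>-space is not
  Asplund representable iff the negation of this predicate holds for every type of class
  \<open>banach\<close>, i.e. with a free type variable in place of \<open>'v\<close>.\<close>

definition Asplund_representable_on ::
  "'v::banach itself \<Rightarrow> ('g, 'm) monoid_scheme \<Rightarrow> 'g topology \<Rightarrow> 'x topology \<Rightarrow>
   ('g \<Rightarrow> 'x \<Rightarrow> 'x) \<Rightarrow> bool" where
  "Asplund_representable_on V G TG X act \<longleftrightarrow>
     Asplund_space V \<and>
     (\<exists>(h :: 'g \<Rightarrow> ('v \<Rightarrow>\<^sub>L 'v)) (\<alpha> :: 'x \<Rightarrow> ('v \<Rightarrow>\<^sub>L real)).
        proper_representation G TG X act h \<alpha>)"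


section \<open>The special linear groups and their actions\<close>

definition SL :: "('a::comm_ring_1 ^ 'n ^ 'n) monoid" where
  "SL = \<lparr>carrier = {A. det A = 1}, mult = (**), one = mat 1\<rparr>"

definition SLZ_linear_act :: "int ^ 'n ^ 'n \<Rightarrow> real ^ 'n \<Rightarrow> real ^ 'n" where
  "SLZ_linear_act g x = map_matrix of_int g *v x"

definition conjugation_act :: "('g, 'm) monoid_scheme \<Rightarrow> 'g \<Rightarrow> 'g \<Rightarrow> 'g" where
  "conjugation_act G g x = g \<otimes>\<^bsub>G\<^esub> x \<otimes>\<^bsub>G\<^esub> inv\<^bsub>G\<^esub> g"

abbreviation SLZ_topology :: "(int ^ 'n ^ 'n) topology" where
  "SLZ_topology \<equiv> discrete_topology (carrier SL)"

abbreviation SLR_topology :: "(real ^ 'n ^ 'n) topology" where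
  "SLR_topology \<equiv> top_of_set (carrier SL)"

section \<open>The structures above are groups and \<open>G\<close>-spaces\<close>

lemma group_Iso: "group (Iso :: ('v::banach \<Rightarrow>\<^sub>L 'v) monoid)"
proof (rule groupI)
  fix u :: "'v \<Rightarrow>\<^sub>L 'v"
  let ?w = "inv_into UNIV (blinfun_apply u)"
  assume "u \<in> carrier Iso"
  then have nrm: "\<And>v. norm (u v) = norm v" and surj: "surj u"
    by (auto simp: Iso_def)
  have inj: "inj u"
  proof (rule injI)
    fix x y assume "u x = u y"
    then have "norm (u (x - y)) = 0" by (simp add: blinfun.diff_right)
    then show "x = y" by (simp add: nrm)
  qed
  have uw: "u (?w x) = x" for x by (rule surj_f_inv_f[OF surj])
  have nrm_w: "norm (?w x) = norm x" for x using nrm[of "?w x"] by (simp add: uw)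
  have bl: "bounded_linear ?w"
  proof (rule bounded_linear_intro[where K = 1])
    show "?w (x + y) = ?w x + ?w y" for x y
      by (rule injD[OF inj]) (simp add: uw blinfun.add_right)
    show "?w (r *\<^sub>R x) = r *\<^sub>R ?w x" for r x
      by (rule injD[OF inj]) (simp add: uw blinfun.scaleR_right)
    show "norm (?w x) \<le> norm x * 1" for x by (simp add: nrm_w)
  qed
  have "\<forall>v. norm (?w v) = norm v" by (simp add: nrm_w)
  moreover have "surj ?w" by (simp add: inj inj_imp_surj_inv)
  moreover have "Blinfun ?w o\<^sub>L u = id_blinfun"
    by (rule blinfun_eqI) (simp add: bounded_linear_Blinfun_apply[OF bl] inj)
  ultimately show "\<exists>w\<in>carrier Iso. w \<otimes>\<^bsub>Iso\<^esub> u = \<one>\<^bsub>Iso\<^esub>"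
    by (intro bexI[where x = "Blinfun ?w"])
       (auto simp: Iso_def bounded_linear_Blinfun_apply[OF bl])
next
  fix u w :: "'v \<Rightarrow>\<^sub>L 'v"
  assume "u \<in> carrier Iso" "w \<in> carrier Iso"
  then show "u \<otimes>\<^bsub>Iso\<^esub> w \<in> carrier Iso"
    using comp_surj[of "blinfun_apply w" "blinfun_apply u"] by (auto simp: Iso_def o_def)
qed (auto simp: Iso_def intro!: blinfun_eqI)

definition adjugate :: "'a::comm_ring_1 ^ 'n ^ 'n \<Rightarrow> 'a ^ 'n ^ 'n" where
  "adjugate A = (\<chi> k m. det (\<chi> i. if i = m then axis k 1 else A $ i))"

lemma mult_adjugate: "A ** adjugate A = mat (det A)"
proof -
  have "(\<Sum>k\<in>UNIV. A $ l $ k * adjugate A $ k $ m) = (if l = m then det A else 0)" for l m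
  proof -
    have "(\<Sum>k\<in>UNIV. A $ l $ k * adjugate A $ k $ m)
        = (\<Sum>k\<in>UNIV. det (\<chi> i. if i = m then A $ l $ k *s axis k 1 else A $ i))"
      unfolding adjugate_def by (simp add: det_row_mul)
    also have "\<dots> = det (\<chi> i. if i = m then (\<Sum>k\<in>UNIV. A $ l $ k *s axis k 1) else A $ i)"
      by (rule det_linear_row_sum[symmetric]) simp
    also have "(\<Sum>k\<in>UNIV. A $ l $ k *s axis k 1) = A $ l"
      by (simp add: basis_expansion)
    also have "det (\<chi> i. if i = m then A $ l else A $ i) = (if l = m then det A else 0)"
    proof (cases "l = m")
      case True
      then have "(\<chi> i. if i = m then A $ l else A $ i) = A" by (simp add: vec_eq_iff)
      then show ?thesis using True by simp
    next
      case False
      then show ?thesis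
        by (subst det_identical_rows[of l m]) (auto simp: row_def)
    qed
    finally show ?thesis .
  qed
  then show ?thesis by (simp add: matrix_matrix_mult_def mat_def vec_eq_iff)
qed

lemma adjugate_SL:
  assumes "A \<in> carrier SL"
  shows "adjugate A \<in> carrier SL" and "adjugate A ** A = mat 1"
proof -
  have step: "adjugate B \<in> carrier SL \<and> B ** adjugate B = mat 1"
    if "B \<in> carrier SL" for B :: "'a ^ 'n ^ 'n"
    using that det_mul[of B "adjugate B"] by (simp add: SL_def mult_adjugate)
  show "adjugate A \<in> carrier SL" using step assms by blast
  then have "adjugate A ** adjugate (adjugate A) = mat 1" using step by blast
  then show "adjugate A ** A = mat 1"
    by (metis assms step matrix_mul_assoc matrix_mul_lid matrix_mul_rid)
qed

lemma group_SL: "group (SL :: ('a::comm_ring_1 ^ 'n ^ 'n) monoid)"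
proof (rule groupI)
  fix A :: "'a ^ 'n ^ 'n" assume "A \<in> carrier SL"
  then show "\<exists>B\<in>carrier SL. B \<otimes>\<^bsub>SL\<^esub> A = \<one>\<^bsub>SL\<^esub>"
    using adjugate_SL[of A] by (intro bexI[of _ "adjugate A"]) (auto simp: SL_def)
qed (auto simp: SL_def det_mul matrix_mul_assoc)

lemma inv_SL: "A \<in> carrier SL \<Longrightarrow> inv\<^bsub>SL\<^esub> A = adjugate A"
  using adjugate_SL[of A] by (intro group.inv_equality[OF group_SL]) (auto simp: SL_def)

lemma Tychonoff_euclidean_subspace: "Tychonoff_space (top_of_set (S :: 'a::metric_space set))"
  by (simp add: Tychonoff_space_def metrizable_imp_completely_regular_space
      metrizable_space_subtopology metrizable_space_euclidean Hausdorff_space_subtopology)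

lemma continuous_on_matrix_mult:
  fixes f g :: "'b::topological_space \<Rightarrow> real ^ 'n ^ 'n"
  assumes "continuous_on S f" "continuous_on S g"
  shows "continuous_on S (\<lambda>x. f x ** g x)"
  unfolding matrix_matrix_mult_def
  by (intro continuous_intros continuous_on_vec_lambda assms)

lemma continuous_on_det:
  fixes f :: "'b::topological_space \<Rightarrow> real ^ 'n ^ 'n"
  assumes "continuous_on S f"
  shows "continuous_on S (\<lambda>x. det (f x))"
  unfolding det_def by (intro continuous_intros assms)

lemma continuous_on_adjugate: "continuous_on S (adjugate :: real ^ 'n ^ 'n \<Rightarrow> _)"
proof -
  have "continuous_on S (\<lambda>A :: real ^ 'n ^ 'n. if i = m then axis k 1 else A $ i)" for i m k :: 'n
    by (cases "i = m") (auto intro: continuous_intros)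
  then show ?thesis
    unfolding adjugate_def by (intro continuous_on_vec_lambda continuous_on_det)
qed

lemma topological_group_SLZ: "topological_group (SL :: (int ^ 'n ^ 'n) monoid) SLZ_topology"
proof -
  interpret group "SL :: (int ^ 'n ^ 'n) monoid" by (rule group_SL)
  show ?thesis
    by (auto simp: topological_group_def group_SL Tychonoff_space_def
        completely_regular_space_discrete_topology Hausdorff_space_discrete_topology
        prod_topology_discrete_topology[symmetric])
qed

lemma topological_group_SLR: "topological_group (SL :: (real ^ 'n ^ 'n) monoid) SLR_topology"
proof -
  interpret group "SL :: (real ^ 'n ^ 'n) monoid" by (rule group_SL)
  have "continuous_on (carrier SL \<times> carrier SL) (\<lambda>(x, y). x \<otimes>\<^bsub>SL\<^esub> y :: real ^ 'n ^ 'n)"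
    by (auto simp: SL_def case_prod_beta intro!: continuous_on_matrix_mult continuous_intros)
  moreover have "continuous_on (carrier SL) (\<lambda>x :: real ^ 'n ^ 'n. inv\<^bsub>SL\<^esub> x)"
    by (subst continuous_on_cong[OF refl inv_SL]) (auto intro: continuous_on_adjugate)
  ultimately show ?thesis
    by (auto simp: topological_group_def group_SL Tychonoff_euclidean_subspace
        simp flip: subtopology_Times)
qed

lemma G_space_SLZ_linear:
  "G_space (SL :: (int ^ 'n ^ 'n) monoid) SLZ_topology (euclidean :: (real ^ 'n) topology) SLZ_linear_act"
proof -
  have "continuous_map (prod_topology SLZ_topology euclidean) euclidean
      (\<lambda>(g :: int ^ 'n ^ 'n, x). SLZ_linear_act g x)"
    unfolding continuous_map_def
  proof (intro conjI allI impI)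
    fix U :: "(real ^ 'n) set" assume U: "openin euclidean U"
    have op: "open {x. SLZ_linear_act g x \<in> U}" for g :: "int ^ 'n ^ 'n"
      using U open_vimage[of U "SLZ_linear_act g"]
      by (simp add: SLZ_linear_act_def vimage_def linear_continuous_on matrix_vector_mul_bounded_linear)
    have "{z \<in> topspace (prod_topology SLZ_topology euclidean). (case z of (g, x) \<Rightarrow> SLZ_linear_act g x) \<in> U}
        = (\<Union>g\<in>carrier SL. {g} \<times> {x. SLZ_linear_act g x \<in> U})" by auto
    moreover have "openin (prod_topology SLZ_topology euclidean) \<dots>"
      using op by (intro openin_Union) (auto simp: openin_prod_Times_iff)
    ultimately show "openin (prod_topology SLZ_topology euclidean)
        {z \<in> topspace (prod_topology SLZ_topology euclidean). (case z of (g, x) \<Rightarrow> SLZ_linear_act g x) \<in> U}"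
      by simp
  qed auto
  moreover have "SLZ_linear_act (mat 1) x = x" for x :: "real ^ 'n"
  proof -
    have "map_matrix of_int (mat 1 :: int ^ 'n ^ 'n) = (mat 1 :: real ^ 'n ^ 'n)"
      by (simp add: vec_eq_iff mat_def)
    then show ?thesis by (simp add: SLZ_linear_act_def)
  qed
  moreover have "SLZ_linear_act (g ** h) x = SLZ_linear_act g (SLZ_linear_act h x)"
    for g h :: "int ^ 'n ^ 'n" and x
  proof -
    have "map_matrix of_int (g ** h) = (map_matrix of_int g ** map_matrix of_int h :: real ^ 'n ^ 'n)"
      by (simp add: vec_eq_iff matrix_matrix_mult_def)
    then show ?thesis by (simp add: SLZ_linear_act_def matrix_vector_mul_assoc)
  qed
  ultimately show ?thesis
    using Tychonoff_euclidean_subspace[of "UNIV :: (real ^ 'n) set"]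
    by (simp add: G_space_def topological_group_SLZ) (simp add: SL_def)
qed

lemma G_space_SLR_conjugation:
  "G_space (SL :: (real ^ 'n ^ 'n) monoid) SLR_topology SLR_topology (conjugation_act SL)"
proof -
  interpret group "SL :: (real ^ 'n ^ 'n) monoid" by (rule group_SL)
  let ?C = "carrier (SL :: (real ^ 'n ^ 'n) monoid)"
  have "continuous_on (?C \<times> ?C) (\<lambda>(g, x). g ** x ** adjugate g)"
    by (auto simp: case_prod_beta intro!: continuous_on_matrix_mult continuous_intros
        continuous_on_compose2[OF continuous_on_adjugate[of UNIV]])
  then have "continuous_on (?C \<times> ?C) (\<lambda>(g, x). conjugation_act SL g x)"
    by (rule continuous_on_eq) (auto simp: conjugation_act_def inv_SL, simp add: SL_def)
  then have "continuous_map (prod_topology SLR_topology SLR_topology) SLR_topology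
      (\<lambda>(g :: real ^ 'n ^ 'n, x). conjugation_act SL g x)"
    by (auto simp: conjugation_act_def simp flip: subtopology_Times)
  moreover have "conjugation_act SL (g \<otimes>\<^bsub>SL\<^esub> h) x = conjugation_act SL g (conjugation_act SL h x)"
    if "g \<in> ?C" "h \<in> ?C" "x \<in> ?C" for g h x
    using that by (simp add: conjugation_act_def inv_mult_group m_assoc)
  moreover have "conjugation_act SL \<one>\<^bsub>SL\<^esub> x = x" if "x \<in> ?C" for x
    using that by (simp add: conjugation_act_def)
  ultimately show ?thesis
    by (simp add: G_space_def topological_group_SLR Tychonoff_euclidean_subspace)
qed

end

theory Submission
  imports Defs
begin

text \<open>
  Restrict a functional-valued map \<open>\<alpha>\<close> to the closed span \<open>W\<close> of a countable orbit of a vector \<open>v\<close>.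
  Since \<open>W\<^sup>*\<close> is separable, Baire's theorem gives a nonempty open set \<open>U\<close> whose image in \<open>W\<^sup>*\<close> has
  small diameter. For \<open>n \<ge> 3\<close> the diagonal action of \<open>SL\<^sub>n(\<int>)\<close> on pairs of vectors is topologically
  transitive, so pairs \<open>(p, q)\<close> arbitrarily close to \<open>(e\<^sub>c, 0)\<close> can be moved into \<open>U \<times> U\<close>. As the
  action on \<open>V\<close> is isometric, \<open>\<alpha> p\<close> and \<open>\<alpha> q\<close> nearly agree at \<open>v\<close>, hence \<open>\<alpha> e\<^sub>c = \<alpha> 0\<close>, contradicting
  injectivity. The conjugation action of \<open>SL\<^sub>n(\<real>)\<close> contains the linear action of \<open>SL\<^sub>n\<^sub>-\<^sub>1(\<int>)\<close> on the
  unipotent matrices \<open>I + x \<otimes> e\<^sub>l\<^sup>T\<close> with \<open>x\<^sub>l = 0\<close>.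
\<close>

section \<open>Separable subspaces and the Baire category argument\<close>

text \<open>Real scalars are limits of rational ones, so passing to limits turns closure under
  rational combinations into a real linear structure.\<close>

lemma subspace_closure_rational_span:
  fixes C :: "'a::real_normed_vector set"
  assumes "0 \<in> C" and add: "\<And>x y. x \<in> C \<Longrightarrow> y \<in> C \<Longrightarrow> x + y \<in> C"
    and scale: "\<And>q x. x \<in> C \<Longrightarrow> real_of_rat q *\<^sub>R x \<in> C"
  shows "subspace (closure C)"
proof (rule subspaceI)
  show "0 \<in> closure C" using assms(1) closure_subset by blast
  fix x y assume "x \<in> closure C" "y \<in> closure C"
  then obtain f g where fg: "\<And>n::nat. f n \<in> C" "f \<longlonglongrightarrow> x" "\<And>n::nat. g n \<in> C" "g \<longlonglongrightarrow> y"
    unfolding closure_sequential by blast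
  then have "(\<lambda>n. f n + g n) \<longlonglongrightarrow> x + y" by (intro tendsto_intros)
  then show "x + y \<in> closure C"
    unfolding closure_sequential
    by (intro exI[of _ "\<lambda>n. f n + g n"] conjI allI add fg)
next
  fix r :: real and x assume "x \<in> closure C"
  have "r \<in> closure \<rat>" by (simp add: Rats_closure_real)
  with \<open>x \<in> closure C\<close> obtain f q where fq: "\<And>n::nat. f n \<in> C" "f \<longlonglongrightarrow> x" "\<And>n::nat. q n \<in> \<rat>" "q \<longlonglongrightarrow> r"
    unfolding closure_sequential by blast
  then have "(\<lambda>n. q n *\<^sub>R f n) \<longlonglongrightarrow> r *\<^sub>R x" by (intro tendsto_intros)
  moreover have "q n *\<^sub>R f n \<in> C" for n
    using fq(1,3)[of n] scale by (auto elim: Rats_cases)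
  ultimately show "r *\<^sub>R x \<in> closure C"
    unfolding closure_sequential by (intro exI[of _ "\<lambda>n. q n *\<^sub>R f n"] conjI allI)
qed

text \<open>The closure of the rational span works: the span itself is a countable dense
  subset.\<close>

lemma separable_closed_subspace_containing:
  fixes A :: "'a::real_normed_vector set"
  assumes "countable A"
  obtains W where "subspace W" "closed W" "separable_space (top_of_set W)" "A \<subseteq> W"
proof
  \<comment> \<open>Combinations are coded by lists of coefficient-vector pairs, so countability of
    the span reduces to countability of lists over a countable set.\<close>
  define comb where "comb = (\<lambda>xs. \<Sum>(q, v)\<leftarrow>xs. real_of_rat q *\<^sub>R (v::'a))"
  define C where "C = comb ` lists (UNIV \<times> A)"
  have "countable C" using assms by (simp add: C_def countable_lists)
  show "subspace (closure C)"
  proof (rule subspace_closure_rational_span)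
    have "comb [] = 0" by (simp add: comb_def)
    then show "0 \<in> C" unfolding C_def by (metis imageI lists.Nil)
  next
    fix x y assume "x \<in> C" "y \<in> C"
    then obtain xs ys where "xs \<in> lists (UNIV \<times> A)" "ys \<in> lists (UNIV \<times> A)" "x = comb xs" "y = comb ys"
      by (auto simp: C_def)
    then have "x + y = comb (xs @ ys)" "xs @ ys \<in> lists (UNIV \<times> A)" by (auto simp: comb_def)
    then show "x + y \<in> C" unfolding C_def by blast
  next
    fix q x assume "x \<in> C"
    then obtain xs where xs: "xs \<in> lists (UNIV \<times> A)" "x = comb xs" by (auto simp: C_def)
    have "real_of_rat q *\<^sub>R comb ys = comb (map (\<lambda>(p, v). (q * p, v)) ys)" for ys
      by (induction ys) (auto simp: comb_def scaleR_add_right of_rat_mult)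
    moreover have "map (\<lambda>(p, v). (q * p, v)) xs \<in> lists (UNIV \<times> A)" using xs(1) by fastforce
    ultimately show "real_of_rat q *\<^sub>R x \<in> C" unfolding C_def using xs(2) by blast
  qed
  show "closed (closure C)" by simp
  show "separable_space (top_of_set (closure C))"
    unfolding separable_space_def using \<open>countable C\<close> closure_subset[of C]
    by (intro exI[of _ C]) (auto simp: closure_of_subtopology Int_absorb1)
  have "comb [(1, v)] = v" for v by (simp add: comb_def)
  moreover have "[(1, v)] \<in> lists (UNIV \<times> A)" if "v \<in> A" for v using that by simp
  ultimately have "A \<subseteq> C" unfolding C_def by (metis imageI subsetI)
  then show "A \<subseteq> closure C" using closure_subset by blast
qed

text \<open>A supremum of reals dominates its members only when the set is bounded above; the
  constant \<open>K\<close> provides this bound on the unit ball.\<close>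

lemma abs_le_dual_norm:
  fixes f :: "'v::real_normed_vector \<Rightarrow> real"
  assumes "\<And>x. x \<in> W \<Longrightarrow> \<bar>f x\<bar> \<le> K * norm x" and "w \<in> W" "norm w \<le> 1"
  shows "\<bar>f w\<bar> \<le> dual_norm W f"
  unfolding dual_norm_def
proof (rule cSUP_upper)
  have "\<bar>f x\<bar> \<le> \<bar>K\<bar>" if "x \<in> W \<inter> cball 0 1" for x
  proof -
    have "\<bar>f x\<bar> \<le> K * norm x" using assms(1) that by simp
    also have "\<dots> \<le> \<bar>K\<bar> * norm x" by (simp add: mult_right_mono)
    also have "\<dots> \<le> \<bar>K\<bar>" using that by (simp add: mult_left_le)
    finally show ?thesis .
  qed
  then show "bdd_above ((\<lambda>x. \<bar>f x\<bar>) ` (W \<inter> cball 0 1))" by (intro bdd_aboveI2)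
qed (use assms in simp)

text \<open>If no member of the cover had relative interior, the complements would be dense and open
  in \<open>X\<close>, so by Baire their intersection would be dense; but a cover leaves it
  empty.\<close>

lemma countable_closed_cover_interior:
  fixes X :: "'a::{real_normed_vector, heine_borel} set"
  assumes "closed X" "X \<noteq> {}" "countable \<C>" "X \<subseteq> \<Union>\<C>"
    and closed: "\<And>F. F \<in> \<C> \<Longrightarrow> closedin (top_of_set X) F"
  obtains F U where "F \<in> \<C>" "openin (top_of_set X) U" "U \<noteq> {}" "U \<subseteq> F"
proof (rule ccontr)
  assume "\<not> thesis"
  with that have no: "\<And>F U. F \<in> \<C> \<Longrightarrow> openin (top_of_set X) U \<Longrightarrow> U \<subseteq> F \<Longrightarrow> U = {}" by blast
  have "X \<subseteq> closure (\<Inter>((\<lambda>F. X - F) ` \<C>))"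
  proof (rule Baire[OF assms(1)])
    show "countable ((\<lambda>F. X - F) ` \<C>)" using assms(3) by simp
    fix T assume "T \<in> (\<lambda>F. X - F) ` \<C>"
    then obtain F where F: "F \<in> \<C>" "T = X - F" by blast
    have op: "openin (top_of_set X) T"
      using closed[OF F(1)] F(2) by (metis closedin_def topspace_euclidean_subtopology)
    have "X - closure T = {}"
    proof (rule no[OF F(1)])
      show "openin (top_of_set X) (X - closure T)"
        by (metis Diff_eq closed_closure open_Compl openin_open)
      show "X - closure T \<subseteq> F" using F(2) closure_subset[of T] by blast
    qed
    then show "openin (top_of_set X) T \<and> X \<subseteq> closure T" using op by blast
  qed
  \<comment> \<open>The intersection of an empty family would be \<open>UNIV\<close>, so this case
    has to be excluded first.\<close>
  moreover have "\<C> \<noteq> {}" using assms(2,4) by auto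
  then have "\<Inter>((\<lambda>F. X - F) ` \<C>) = {}" using assms(4) by auto
  ultimately show False using assms(2) by simp
qed

text \<open>The restrictions of the functionals to a separable \<open>W\<close> containing
  \<open>A\<close> lie in a separable dual, so countably many balls of radius \<open>e / 2\<close>
  cover them. Their preimages in \<open>X\<close> are closed, and one has interior.\<close>

lemma Asplund_small_oscillation:
  fixes \<beta> :: "'a::{real_normed_vector, heine_borel} \<Rightarrow> ('v::banach \<Rightarrow>\<^sub>L real)"
  assumes "Asplund_space TYPE('v)" "countable A" "closed X" "X \<noteq> {}" "e > 0"
    and cont: "\<And>v. continuous_on X (\<lambda>x. \<beta> x v)"
  obtains U where "openin (top_of_set X) U" "U \<noteq> {}"
    "\<And>x y w. x \<in> U \<Longrightarrow> y \<in> U \<Longrightarrow> w \<in> A \<Longrightarrow> norm w \<le> 1 \<Longrightarrow> \<bar>\<beta> x w - \<beta> y w\<bar> \<le> e"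
proof -
  obtain W where W: "subspace W" "closed W" "separable_space (top_of_set W)" "A \<subseteq> W"
    using separable_closed_subspace_containing[OF assms(2)] .
  then have "separable_dual W" using assms(1) by (simp add: Asplund_space_def)
  then obtain D where D: "D \<subseteq> subspace_dual W" "countable D"
      and dense: "\<And>f e. f \<in> subspace_dual W \<Longrightarrow> e > 0 \<Longrightarrow> \<exists>d\<in>D. dual_norm W (\<lambda>x. f x - d x) < e"
    unfolding separable_dual_def by blast
  \<comment> \<open>The condition is imposed vector by vector instead of through
    \<open>dual_norm\<close>: each vector gives a closed condition by pointwise continuity
    alone.\<close>
  define F where "F d = {x \<in> X. \<forall>w \<in> W \<inter> cball 0 1. \<bar>\<beta> x w - d w\<bar> \<le> e / 2}" for d
  have cl: "closedin (top_of_set X) (F d)" for d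
  proof -
    have "closedin (top_of_set X) {x \<in> X. \<bar>\<beta> x w - d w\<bar> \<le> e / 2}" for w
    proof -
      have "continuous_on X (\<lambda>x. \<bar>\<beta> x w - d w\<bar>)" by (intro continuous_intros cont)
      from continuous_closedin_preimage[OF this, of "{..e/2}"] show ?thesis
        by (simp add: vimage_def Int_def)
    qed
    \<comment> \<open>The zero vector keeps the index set of the intersection nonempty.\<close>
    then have "closedin (top_of_set X) (\<Inter>w\<in>W \<inter> cball 0 1. {x \<in> X. \<bar>\<beta> x w - d w\<bar> \<le> e / 2})"
      using subspace_0[OF W(1)] by (intro closedin_INT) auto
    also have "(\<Inter>w\<in>W \<inter> cball 0 1. {x \<in> X. \<bar>\<beta> x w - d w\<bar> \<le> e / 2}) = F d"
      using subspace_0[OF W(1)] by (auto simp: F_def)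
    finally show ?thesis .
  qed
  have cover: "X \<subseteq> \<Union>(F ` D)"
  proof
    fix x assume "x \<in> X"
    \<comment> \<open>Members of \<open>subspace_dual W\<close> are extensional, hence the
      restriction.\<close>
    define f where "f = restrict (\<beta> x) W"
    have f: "f \<in> subspace_dual W"
      using W(1) norm_blinfun[of "\<beta> x"]
      by (auto simp: subspace_dual_def f_def subspace_add subspace_scale blinfun.add_right blinfun.scaleR_right)
    obtain d where d: "d \<in> D" "dual_norm W (\<lambda>x. f x - d x) < e / 2"
      using dense[OF f, of "e / 2"] \<open>e > 0\<close> by auto
    obtain K L where "\<forall>y\<in>W. \<bar>f y\<bar> \<le> K * norm y" "\<forall>y\<in>W. \<bar>d y\<bar> \<le> L * norm y"
      using f d(1) D(1) unfolding subspace_dual_def by blast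
    then have KL: "\<bar>f y - d y\<bar> \<le> (K + L) * norm y" if "y \<in> W" for y
      using that abs_triangle_ineq4[of "f y" "d y"] by (force simp: distrib_right)
    have "\<bar>\<beta> x w - d w\<bar> \<le> e / 2" if "w \<in> W \<inter> cball 0 1" for w
      using abs_le_dual_norm[of W "\<lambda>x. f x - d x" "K + L" w] KL that d(2) by (simp add: f_def)
    then have "x \<in> F d" using \<open>x \<in> X\<close> unfolding F_def by blast
    then show "x \<in> \<Union>(F ` D)" using d(1) by blast
  qed
  have "countable (F ` D)" using D(2) by simp
  moreover have "\<And>G. G \<in> F ` D \<Longrightarrow> closedin (top_of_set X) G" using cl by blast
  ultimately obtain G U where "G \<in> F ` D" and U: "openin (top_of_set X) U" "U \<noteq> {}" "U \<subseteq> G"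
    using countable_closed_cover_interior[OF assms(3,4) _ cover] by blast
  then obtain d where d: "U \<subseteq> F d" by blast
  show thesis
  proof (rule that[OF U(1,2)])
    fix x y w assume "x \<in> U" "y \<in> U" "w \<in> A" "norm w \<le> 1"
    then have "x \<in> F d" "y \<in> F d" "w \<in> W \<inter> cball 0 1"
      using d W(4) by auto
    then have "\<bar>\<beta> x w - d w\<bar> \<le> e / 2" "\<bar>\<beta> y w - d w\<bar> \<le> e / 2"
      unfolding F_def by blast+
    then show "\<bar>\<beta> x w - \<beta> y w\<bar> \<le> e" by linarith
  qed
qed

section \<open>Transvections and block subgroups of SL\<close>

text \<open>This is the transvection \<open>I + f e_i^T\<close>. Over the integers it generates the
  group elements needed; over the reals it gives the unipotent matrices on which conjugation is
  studied.\<close>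

definition shear :: "'a::comm_ring_1 ^ 'n \<Rightarrow> 'n \<Rightarrow> 'a ^ 'n ^ 'n" where
  "shear f i = mat 1 + (\<chi> k. f $ k *s axis i 1)"

lemma det_shear:
  fixes f :: "'a::comm_ring_1 ^ 'n"
  assumes "f $ i = 0"
  shows "det (shear f i) = 1"
proof -
  \<comment> \<open>Only the rows in \<open>T\<close> are altered. Since \<open>i\<close> is not in
    \<open>T\<close>, row \<open>i\<close> stays a unit vector, and enlarging \<open>T\<close> by
    \<open>m\<close> adds a multiple of it to row \<open>m\<close>, preserving the
    determinant.\<close>
  define M where "M T = (\<chi> k. if k \<in> T then axis k 1 + f $ k *s axis i 1 else (axis k 1 :: 'a ^ 'n))" for T
  have "det (M T) = 1" if "i \<notin> T" for T
    using finite[of T] that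
  proof (induction T rule: finite_induct)
    case empty
    have "M {} = mat 1" by (simp add: M_def vec_eq_iff mat_def axis_def)
    then show ?case by simp
  next
    case (insert m T)
    then have "m \<noteq> i" by auto
    have "M (insert m T) = (\<chi> k. if k = m then row m (M T) + f $ m *s row i (M T) else row k (M T))"
      using insert by (simp add: M_def vec_eq_iff row_def)
    then show ?case using det_row_operation[OF \<open>m \<noteq> i\<close>, of "M T" "f $ m"] insert by simp
  qed
  moreover have "shear f i = M (- {i})"
    using assms by (auto simp: shear_def M_def vec_eq_iff mat_def axis_def)
  ultimately show ?thesis by simp
qed

lemma shear_mult_vec: "shear f i *v x = x + x $ i *s f"
proof -
  have "(\<Sum>j\<in>UNIV. (f $ k * axis i 1 $ j) * x $ j) = (\<Sum>j\<in>UNIV. if j = i then f $ k * x $ i else 0)" for k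
    by (intro sum.cong) (auto simp: axis_def)
  then have "(\<chi> k. f $ k *s axis i 1) *v x = x $ i *s f"
    by (simp add: vec_eq_iff matrix_vector_mult_def mult.commute)
  then show ?thesis
    by (simp add: shear_def matrix_vector_mult_add_rdistrib)
qed

text \<open>The copy of \<open>SL\<close> acting on the coordinates in \<open>S\<close>; it plays the role of \<open>SL\<^sub>n\<^sub>-\<^sub>1\<close>, for which
  there is no index type.\<close>

definition block_SL :: "'n set \<Rightarrow> ('a::comm_ring_1 ^ 'n ^ 'n) set" where
  "block_SL S = {A \<in> carrier SL. \<forall>i j. i \<notin> S \<or> j \<notin> S \<longrightarrow> A $ i $ j = mat 1 $ i $ j}"

lemma block_SL_one: "mat 1 \<in> block_SL S"
  by (simp add: block_SL_def SL_def)

lemma block_SL_mult: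
  assumes "A \<in> block_SL S" "B \<in> block_SL S"
  shows "A ** B \<in> block_SL S"
proof -
  have "(A ** B) $ i $ j = mat 1 $ i $ j" if "i \<notin> S \<or> j \<notin> S" for i j
    using that
  proof
    assume "i \<notin> S"
    then have "A $ i = mat 1 $ i" using assms(1) by (simp add: block_SL_def vec_eq_iff)
    then have "(A ** B) $ i $ j = (mat 1 ** B) $ i $ j" by (simp add: matrix_matrix_mult_def)
    then show ?thesis using \<open>i \<notin> S\<close> assms(2) by (simp add: block_SL_def)
  next
    assume "j \<notin> S"
    then have "\<And>k. B $ k $ j = mat 1 $ k $ j" using assms(2) by (simp add: block_SL_def)
    then have "(A ** B) $ i $ j = (A ** mat 1) $ i $ j" by (simp add: matrix_matrix_mult_def)
    then show ?thesis using \<open>j \<notin> S\<close> assms(1) by (simp add: block_SL_def)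
  qed
  then show ?thesis using assms by (simp add: block_SL_def SL_def det_mul)
qed

lemma shear_in_block_SL:
  assumes "i \<in> S" "f $ i = 0" "\<And>k. k \<notin> S \<Longrightarrow> f $ k = 0"
  shows "shear f i \<in> block_SL S"
  using assms by (auto simp: block_SL_def SL_def det_shear) (auto simp: shear_def axis_def)

lemma block_SL_mono: "S \<subseteq> T \<Longrightarrow> block_SL S \<subseteq> block_SL T"
  unfolding block_SL_def by blast

lemma block_SL_fixes_axis:
  assumes "A \<in> block_SL S" "j \<notin> S"
  shows "A *v axis j 1 = axis j 1"
proof -
  have "A $ i $ k * axis j 1 $ k = mat 1 $ i $ k * axis j 1 $ k" for i k
    using assms by (simp add: block_SL_def axis_def)
  then have "A *v axis j 1 = mat 1 *v axis j 1" by (simp add: matrix_vector_mult_def)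
  then show ?thesis by simp
qed

section \<open>Integer matrices with prescribed columns\<close>

text \<open>Euclid's algorithm: the pair \<open>(- y, x mod y)\<close> is a column by induction, the
  quarter turn takes it to \<open>(x mod y, y)\<close>, and a shear by \<open>x div y\<close>
  restores \<open>(x, y)\<close>.\<close>

lemma block_SL_coprime_column:
  fixes x y :: int and a c :: "'n::finite"
  assumes "coprime x y" "a \<noteq> c"
  shows "\<exists>A \<in> block_SL {a, c}. A *v axis a 1 = axis a x + axis c y"
  using assms(1)
proof (induction "nat \<bar>y\<bar>" arbitrary: x y rule: less_induct)
  case less
  define T where "T p q k = shear (axis q k :: int ^ 'n) p" for p q k
  have T: "T a c k \<in> block_SL {a, c}" "T c a k \<in> block_SL {a, c}" for k
    using assms(2) by (auto simp: T_def axis_def intro!: shear_in_block_SL split: if_splits)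
  have T_act: "T a c k *v (axis a u + axis c v) = axis a u + axis c (v + k * u)"
      "T c a k *v (axis a u + axis c v) = axis a (u + k * v) + axis c v" for k u v
    using assms(2) by (auto simp: T_def shear_mult_vec vec_eq_iff axis_def)
  \<comment> \<open>A quarter turn in the plane of \<open>a\<close> and \<open>c\<close>; it serves as the swap in Euclid's algorithm.\<close>
  define J where "J = T c a 1 ** T a c (-1) ** T c a 1"
  have J: "J \<in> block_SL {a, c}" using T by (simp add: J_def block_SL_mult)
  have J_act: "J *v (axis a u + axis c v) = axis a v + axis c (- u)" for u v
    by (simp add: J_def T_act flip: matrix_vector_mul_assoc)
  show ?case
  proof (cases "y = 0")
    case True
    then consider "x = 1" | "x = -1" using less.prems by (auto simp: abs_if split: if_splits)
    then show ?thesis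
    proof cases
      case 1
      then show ?thesis using True block_SL_one by (intro bexI[of _ "mat 1"]) auto
    next
      case 2
      \<comment> \<open>Two quarter turns make the half turn, which negates
        \<open>axis a 1\<close>.\<close>
      have ax: "axis a 1 + axis c (0::int) = axis a 1" by (simp add: vec_eq_iff axis_def)
      then have "(J ** J) *v axis a 1 = axis a x + axis c y"
        using J_act[of 1 0, unfolded ax] J_act[of 0 "-1"] 2 True by (simp flip: matrix_vector_mul_assoc)
      then show ?thesis using J block_SL_mult by blast
    qed
  next
    case False
    have "nat \<bar>x mod y\<bar> < nat \<bar>y\<bar>" using False abs_mod_less[of y x] by linarith
    moreover have "coprime (- y) (x mod y)" using less.prems False
      by (simp add: ac_simps)
    ultimately obtain A where A: "A \<in> block_SL {a, c}" "A *v axis a 1 = axis a (- y) + axis c (x mod y)"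
      using less.hyps by blast
    have "(T c a (x div y) ** J ** A) *v axis a 1 = axis a x + axis c y"
      using A(2) by (simp add: J_act T_act flip: matrix_vector_mul_assoc)
    then show ?thesis using A(1) J T block_SL_mult by blast
  qed
qed

text \<open>The two columns differ by a unit vector only, which becomes negligible after division by
  a large \<open>N\<close>. This makes it possible to move two points to nearly the same
  place.\<close>

lemma block_SL_close_columns:
  fixes B :: "int ^ 'n"
  assumes "distinct [a, b, c]" "{a, b, c} \<subseteq> S" "\<And>k. k \<notin> S \<Longrightarrow> B $ k = 0"
    and "coprime (B $ a) (B $ c)"
  shows "\<exists>A \<in> block_SL S. A *v axis a 1 = B \<and> A *v axis b 1 = B + axis b 1"
proof -
  have ne: "a \<noteq> b" "a \<noteq> c" "b \<noteq> c" "b \<noteq> a" "c \<noteq> a" "c \<noteq> b" using assms(1) by auto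
  obtain F where F: "F \<in> block_SL {a, c}" "F *v axis a 1 = axis a (B $ a) + axis c (B $ c)"
    using block_SL_coprime_column[OF assms(4), of a c] ne by auto
  have Fb: "F *v axis b 1 = axis b 1" using block_SL_fixes_axis[OF F(1), of b] ne by auto
  \<comment> \<open>By the Bezout identity, the shears along \<open>s *s f\<close> and
    \<open>t *s f\<close> together add exactly one copy of \<open>f\<close>, the part of
    \<open>B\<close> off \<open>a\<close> and \<open>c\<close>.\<close>
  obtain s t where st: "s * B $ a + t * B $ c = 1"
    using bezout_int[of "B $ a" "B $ c"] assms(4) by (auto simp: coprime_iff_gcd_eq_1)
  define f where "f = (\<chi> k. if k = a \<or> k = c then 0 else B $ k)"
  \<comment> \<open>The rightmost shear sends \<open>axis b 1\<close> to
    \<open>axis a 1 + axis b 1\<close>; the other factors fix \<open>axis b 1\<close> and carry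
    \<open>axis a 1\<close> to \<open>B\<close>.\<close>
  define A where "A = shear (t *s f) c ** shear (s *s f) a ** F ** shear (axis a 1) b"
  have "F \<in> block_SL S" using F(1) block_SL_mono[of "{a, c}" S] assms(2) by auto
  then have "A \<in> block_SL S"
    unfolding A_def using assms ne by (intro block_SL_mult shear_in_block_SL) (auto simp: f_def axis_def)
  have "axis a (B $ a) + axis c (B $ c) + (s * B $ a + t * B $ c) *s f = B"
    unfolding st using ne by (auto simp: f_def vec_eq_iff axis_def)
  then have lift: "axis a (B $ a) + axis c (B $ c) + (B $ a * s) *s f + (B $ c * t) *s f = B"
    by (simp add: vec_eq_iff algebra_simps)
  have "shear (axis a 1) b *v axis a 1 = (axis a 1 :: int ^ 'n)"
      "shear (axis a 1) b *v axis b 1 = (axis a 1 + axis b 1 :: int ^ 'n)"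
    using ne by (auto simp: shear_mult_vec vec_eq_iff axis_def)
  moreover have "shear (t *s f) c *v (shear (s *s f) a *v (axis a (B $ a) + axis c (B $ c))) = B"
    using lift by (simp add: shear_mult_vec f_def ne axis_def)
  moreover have "shear (t *s f) c *v (shear (s *s f) a *v axis b 1) = axis b 1"
    by (simp add: shear_mult_vec ne axis_def)
  ultimately have "A *v axis a 1 = B" "A *v axis b 1 = B + axis b 1"
    by (simp_all add: A_def F(2) Fb matrix_vector_right_distrib flip: matrix_vector_mul_assoc)
  then show ?thesis using \<open>A \<in> block_SL S\<close> by blast
qed

section \<open>Rational approximation and transitivity on pairs\<close>

text \<open>Rounding alone need not give coprime numerators. Coordinates \<open>a\<close> and
  \<open>c\<close> are first rounded with denominator \<open>m\<close>; after scaling by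
  \<open>K\<close>, adding 1 to the numerator at \<open>c\<close> costs only
  \<open>1 / N\<close>.\<close>

lemma coprime_rational_approximation:
  fixes u :: "real ^ 'n"
  assumes "a \<noteq> c" "r > 0" "\<And>k. k \<notin> S \<Longrightarrow> u $ k = 0" "{a, c} \<subseteq> S"
  obtains N :: nat and B :: "int ^ 'n" where "N > N0" "coprime (B $ a) (B $ c)"
    "\<And>k. \<bar>B $ k / N - u $ k\<bar> < r" "\<And>k. k \<notin> S \<Longrightarrow> B $ k = 0"
proof -
  obtain m :: nat where m: "m > 0" "2 / m < r"
    using reals_Archimedean2[of "2 / r"] assms(2)
    by (metis divide_less_eq divide_pos_pos mult.commute of_nat_0_less_iff order_less_trans zero_less_numeral)
  have floor_err: "\<bar>\<lfloor>M * y\<rfloor> / M - y\<bar> \<le> 1 / M" if "M > 0" for M y :: real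
  proof -
    have "\<bar>\<lfloor>M * y\<rfloor> - M * y\<bar> \<le> 1" by linarith
    moreover have "\<lfloor>M * y\<rfloor> / M - y = (\<lfloor>M * y\<rfloor> - M * y) / M" using that by (simp add: field_simps)
    ultimately show ?thesis using that by (simp add: divide_right_mono)
  qed
  \<comment> \<open>\<open>p \<noteq> 0\<close> divides \<open>K\<close>, so \<open>p * K\<close> and \<open>q * K + 1\<close> are coprime.\<close>
  define p where "p = (if \<lfloor>m * u $ a\<rfloor> = 0 then 1 else \<lfloor>m * u $ a\<rfloor>)"
  define q where "q = \<lfloor>m * u $ c\<rfloor>"
  define K where "K = nat (p * p) * Suc N0"
  define N where "N = m * K"
  define B where "B = (\<chi> k. if k = a then p * K else if k = c then q * K + 1 else \<lfloor>N * u $ k\<rfloor>)"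
  have "p \<noteq> 0" by (simp add: p_def)
  then have pp: "p * p > 0" by (metis power2_eq_square zero_less_power2)
  then have "nat (p * p) \<ge> 1" by linarith
  then have "K \<ge> Suc N0" unfolding K_def by (metis mult_le_mono1 mult_1)
  have "N \<ge> K" using m(1) by (simp add: N_def)
  have "N \<ge> m" using \<open>K \<ge> Suc N0\<close> by (simp add: N_def)
  with \<open>N \<ge> K\<close> have N: "N > N0" "N > 0" "N \<ge> m" using \<open>K \<ge> Suc N0\<close> m(1) by linarith+
  have K: "int K = p * (p * Suc N0)" using pp by (simp add: K_def algebra_simps)
  have "coprime (p * K) (q * K + 1)"
  proof (rule coprimeI)
    fix d assume "d dvd p * int K" "d dvd q * int K + 1"
    have "coprime d (int K)"
      by (metis \<open>d dvd q * int K + 1\<close> coprime_add_one_left coprime_divisors coprime_mult_left_iff dvd_refl dvd_triv_right)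
    then have "d dvd p" using \<open>d dvd p * int K\<close> by (simp add: coprime_dvd_mult_left_iff)
    then have "d dvd q * int K" unfolding K by simp
    then show "is_unit d" using \<open>d dvd q * int K + 1\<close> by (simp add: dvd_add_right_iff)
  qed
  then have cop: "coprime (B $ a) (B $ c)" using assms(1) by (simp add: B_def)
  have inv: "1 / N \<le> 1 / real m" using N m(1) by (simp add: frac_le)
  have err: "\<bar>B $ k / N - u $ k\<bar> \<le> 2 / m" for k
  proof -
    consider "k = a" | "k = c" | "k \<noteq> a" "k \<noteq> c" by blast
    then show ?thesis
    proof cases
      case 1
      have "\<bar>p / m - u $ a\<bar> \<le> 1 / m"
      proof (cases "\<lfloor>m * u $ a\<rfloor> = 0")
        \<comment> \<open>Here \<open>p\<close> is 1, not the floor, but \<open>m * u $ a\<close>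
          lies between 0 and 1, so the error is still at most \<open>1 / m\<close>.\<close>
        case True
        then have "0 \<le> m * u $ a" "m * u $ a \<le> 1" by linarith+
        then have "0 \<le> u $ a" "u $ a \<le> 1 / m" using m(1) by (auto simp: field_simps zero_le_mult_iff)
        then show ?thesis using True by (simp add: p_def)
      next
        case False
        then show ?thesis using floor_err[of m "u $ a"] m(1) by (simp add: p_def)
      qed
      moreover have "B $ a / N = p / m"
        using \<open>K \<ge> Suc N0\<close> by (simp add: B_def N_def)
      moreover have "1 / real m \<le> 2 / m" by (simp add: divide_right_mono)
      ultimately show ?thesis using 1 by simp
    next
      case 2
      have "\<bar>q / m - u $ c\<bar> \<le> 1 / m" using floor_err[of m "u $ c"] m(1) by (simp add: q_def)
      moreover have "B $ c / N = q / m + 1 / N"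
        using \<open>K \<ge> Suc N0\<close> assms(1) by (simp add: B_def N_def add_divide_distrib)
      moreover have "0 \<le> 1 / real N" "2 / real m = 1 / m + 1 / m" by simp_all
      ultimately show ?thesis unfolding 2 using inv by linarith
    next
      case 3
      then have "\<bar>B $ k / N - u $ k\<bar> \<le> 1 / N" using floor_err[of N "u $ k"] N by (simp add: B_def)
      also have "\<dots> \<le> 2 / m" using inv by (smt (verit) divide_right_mono of_nat_0_le_iff)
      finally show ?thesis .
    qed
  qed
  show thesis
  proof (rule that[OF N(1) cop])
    show "\<bar>B $ k / N - u $ k\<bar> < r" for k using err[of k] m(2) by linarith
    show "B $ k = 0" if "k \<notin> S" for k using that assms(3,4) by (auto simp: B_def)
  qed
qed

lemma SLZ_linear_act_mult:
  assumes "A \<in> carrier SL" "B \<in> carrier SL"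
  shows "SLZ_linear_act (A ** B) x = SLZ_linear_act A (SLZ_linear_act B x)"
proof -
  have "A ** B = A \<otimes>\<^bsub>SL\<^esub> B" by (simp add: SL_def)
  then show ?thesis using G_space_SLZ_linear assms by (auto simp: G_space_def)
qed

text \<open>Points with common denominator \<open>N\<close> move by integer arithmetic on
  numerators, so the results on integer columns apply to them.\<close>

lemma SLZ_linear_act_of_int:
  "SLZ_linear_act A (\<chi> k. of_int (z $ k) / N) = (\<chi> k. of_int ((A *v z) $ k) / N)"
  by (simp add: SLZ_linear_act_def matrix_vector_mult_def vec_eq_iff sum_divide_distrib)

lemma SLZ_linear_act_axis:
  "SLZ_linear_act A (axis a (1 / N)) = (\<chi> k. of_int ((A *v axis a 1) $ k) / N)"
proof -
  have "axis a (1 / N) = (\<chi> k. of_int (axis a 1 $ k) / N)" by (simp add: vec_eq_iff axis_def)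
  then show ?thesis by (simp add: SLZ_linear_act_of_int)
qed

lemma SLZ_linear_act_shear:
  fixes f :: "int ^ 'n"
  shows "SLZ_linear_act (shear f i) x = x + x $ i *s (\<chi> k. of_int (f $ k))"
proof -
  have "map_matrix of_int (shear f i) = (shear (\<chi> k. of_int (f $ k)) i :: real ^ 'n ^ 'n)"
    by (simp add: vec_eq_iff shear_def mat_def axis_def)
  then show ?thesis by (simp add: SLZ_linear_act_def shear_mult_vec)
qed

lemma SLZ_linear_act_outside_block:
  assumes "A \<in> block_SL S" "i \<notin> S"
  shows "SLZ_linear_act A x $ i = x $ i"
proof -
  have "of_int (A $ i $ j) * x $ j = (if i = j then x $ j else 0)" for j
    using assms by (simp add: block_SL_def mat_def)
  then have "SLZ_linear_act A x $ i = (\<Sum>j\<in>UNIV. if i = j then x $ j else 0)"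
    by (simp add: SLZ_linear_act_def matrix_vector_mult_def)
  then show ?thesis by simp
qed

text \<open>For large \<open>N\<close> the two points moved are close to \<open>axis c 1\<close> and
  0. A shear first removes the \<open>axis c 1\<close> from the former; then a matrix with two
  nearby columns sends both close to \<open>u\<close>.\<close>

lemma block_SL_pair_transitive:
  fixes u :: "real ^ 'n"
  assumes "distinct [a, b, c]" "{a, b, c} \<subseteq> S" "\<And>k. k \<notin> S \<Longrightarrow> u $ k = 0" "r > 0"
  obtains N :: nat and A where "N > N0" "A \<in> block_SL S"
    "dist (SLZ_linear_act A (axis a (1 / N) + axis c 1)) u < r" "dist (SLZ_linear_act A (axis b (1 / N))) u < r"
proof -
  have ne: "a \<noteq> b" "a \<noteq> c" "b \<noteq> c" "b \<noteq> a" "c \<noteq> a" "c \<noteq> b" using assms(1) by auto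
  \<comment> \<open>The distance is bounded by the sum of the coordinate errors, each below
    \<open>2 * r'\<close>: one \<open>r'\<close> for the approximation of \<open>u\<close>, one for
    the extra \<open>1 / N\<close>.\<close>
  define r' where "r' = r / (2 * CARD('n))"
  have r': "r' > 0" using assms(4) by (simp add: r'_def)
  obtain M :: nat where M: "M > 1 / r'" using reals_Archimedean2 by blast
  have "{a, c} \<subseteq> S" using assms(2) by auto
  from coprime_rational_approximation[OF ne(2) r' assms(3) this]
  obtain N :: nat and B :: "int ^ 'n" where N: "N > max N0 M" and cop: "coprime (B $ a) (B $ c)"
    and B: "\<And>k. \<bar>B $ k / N - u $ k\<bar> < r'" "\<And>k. k \<notin> S \<Longrightarrow> B $ k = 0"
    by metis
  have "1 / r' < N" using M N by linarith
  then have N': "1 / real N < r'" "N > 0" using N r' by (auto simp: field_simps)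
  obtain A where A: "A \<in> block_SL S" "A *v axis a 1 = B" "A *v axis b 1 = B + axis b 1"
    using block_SL_close_columns[OF assms(1,2) B(2) cop] by blast
  have close: "dist x u < r" if "\<And>k. \<bar>x $ k - u $ k\<bar> < 2 * r'" for x
  proof -
    have "dist x u \<le> (\<Sum>k\<in>UNIV. \<bar>(x - u) $ k\<bar>)" unfolding dist_norm by (rule norm_le_l1_cart)
    also have "\<dots> < (\<Sum>k\<in>(UNIV::'n set). 2 * r')" using that by (intro sum_strict_mono) auto
    also have "\<dots> = r" by (simp add: r'_def)
    finally show ?thesis .
  qed
  \<comment> \<open>The coefficient \<open>- N\<close> times the coordinate \<open>1 / N\<close> at
    \<open>a\<close> cancels the 1 at \<open>c\<close>, while \<open>axis b (1 / N)\<close> has no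
    coordinate at \<open>a\<close> and stays fixed.\<close>
  define H where "H = shear (axis c (- int N)) a"
  have H: "H \<in> block_SL S"
    unfolding H_def using assms(2) ne by (intro shear_in_block_SL) (auto simp: axis_def)
  have H_act: "SLZ_linear_act H (axis a (1 / N) + axis c 1) = axis a (1 / N)"
      "SLZ_linear_act H (axis b (1 / N)) = axis b (1 / N)"
    using N'(2) ne by (auto simp: H_def SLZ_linear_act_shear vec_eq_iff axis_def)
  have carrier: "A \<in> carrier SL" "H \<in> carrier SL" using A(1) H by (auto simp: block_SL_def)
  have act: "SLZ_linear_act (A ** H) (axis a (1 / N) + axis c 1) = (\<chi> k. B $ k / N)"
      "SLZ_linear_act (A ** H) (axis b (1 / N)) = (\<chi> k. (B + axis b 1) $ k / N)"
    by (simp_all only: SLZ_linear_act_mult[OF carrier] H_act) (simp_all only: SLZ_linear_act_axis A)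
  show thesis
  proof (rule that[of N "A ** H"])
    show "N0 < N" using N by simp
    show "A ** H \<in> block_SL S" using A(1) H by (rule block_SL_mult)
    show "dist (SLZ_linear_act (A ** H) (axis a (1 / N) + axis c 1)) u < r"
      unfolding act(1)
    proof (rule close)
      show "\<bar>(\<chi> k. B $ k / N) $ k - u $ k\<bar> < 2 * r'" for k
        unfolding vec_lambda_beta using B(1)[of k] r' by linarith
    qed
    show "dist (SLZ_linear_act (A ** H) (axis b (1 / N))) u < r"
      unfolding act(2)
    proof (rule close)
      fix k
      have "\<bar>(B + axis b 1) $ k / N - B $ k / N\<bar> \<le> 1 / N"
        by (cases "k = b") (auto simp: axis_def add_divide_distrib)
      then show "\<bar>(\<chi> k. (B + axis b 1) $ k / N) $ k - u $ k\<bar> < 2 * r'"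
        unfolding vec_lambda_beta using B(1)[of k] N'(1) by linarith
    qed
  qed
qed

section \<open>The collapse argument\<close>

text \<open>Formulated for a map \<open>\<beta>\<close> on the vectors supported in
  \<open>S\<close>, so that it serves both the linear action and the unipotent matrices inside the
  conjugation action.\<close>

lemma Asplund_block_SL_collapse:
  fixes \<beta> :: "real ^ 'n \<Rightarrow> ('v::banach \<Rightarrow>\<^sub>L real)" and f :: "int ^ 'n ^ 'n \<Rightarrow> 'v \<Rightarrow> 'v"
  assumes "Asplund_space TYPE('v)" and abc: "distinct [a, b, c]" "{a, b, c} \<subseteq> S"
    and X: "X = {x. \<forall>k. k \<notin> S \<longrightarrow> x $ k = 0}"
    and cont: "\<And>v. continuous_on X (\<lambda>x. \<beta> x v)"
    and equiv: "\<And>A x v. A \<in> block_SL S \<Longrightarrow> x \<in> X \<Longrightarrow> \<beta> (SLZ_linear_act A x) (f A v) = \<beta> x v"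
    and iso: "\<And>A v. A \<in> block_SL S \<Longrightarrow> norm (f A v) = norm v"
  shows "\<beta> (axis c 1) = \<beta> 0"
proof (rule ccontr)
  assume "\<beta> (axis c 1) \<noteq> \<beta> 0"
  then obtain v0 where "\<beta> (axis c 1) v0 \<noteq> \<beta> 0 v0" by (metis blinfun_eqI)
  define v where "v = v0 /\<^sub>R norm v0"
  \<comment> \<open>A third, since three differences are chained: from \<open>axis c 1\<close> to
    \<open>p\<close>, from \<open>p\<close> to \<open>q\<close>, and from \<open>q\<close> to
    0.\<close>
  define e where "e = \<bar>\<beta> (axis c 1) v - \<beta> 0 v\<bar> / 3"
  have "v0 \<noteq> 0" using \<open>\<beta> (axis c 1) v0 \<noteq> \<beta> 0 v0\<close> by auto
  then have v: "norm v \<le> 1" and e: "e > 0"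
    using \<open>\<beta> (axis c 1) v0 \<noteq> \<beta> 0 v0\<close> by (auto simp: v_def e_def blinfun.scaleR_right)
  have "closed X"
  proof -
    have "X = (\<Inter>k\<in>- S. {x. x $ k = 0})" by (auto simp: X)
    moreover have "closed {x :: real ^ 'n. x $ k = 0}" for k
      by (intro closed_Collect_eq continuous_intros)
    ultimately show ?thesis by auto
  qed
  have X0: "0 \<in> X" "axis c 1 \<in> X" using abc(2) by (auto simp: X axis_def)
  then have "X \<noteq> {}" by blast
  \<comment> \<open>There are only countably many integer matrices; this is what puts all the
    translates of \<open>v\<close> into one separable subspace.\<close>
  have "countable (range (\<lambda>A. f A v))" by simp
  then obtain U where U: "openin (top_of_set X) U" "U \<noteq> {}"
    and osc: "\<And>x y w. x \<in> U \<Longrightarrow> y \<in> U \<Longrightarrow> w \<in> range (\<lambda>A. f A v) \<Longrightarrow> norm w \<le> 1 \<Longrightarrow> \<bar>\<beta> x w - \<beta> y w\<bar> \<le> e"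
    using Asplund_small_oscillation[OF assms(1) _ \<open>closed X\<close> \<open>X \<noteq> {}\<close> e cont] by metis
  from U obtain u where "u \<in> U" "u \<in> X" by (metis all_not_in_conv openin_imp_subset subsetD)
  with U obtain r where r: "r > 0" "\<And>x. x \<in> X \<Longrightarrow> dist x u < r \<Longrightarrow> x \<in> U"
    by (metis openin_euclidean_subtopology_iff)
  obtain d where d: "d > 0" "\<And>x. x \<in> X \<Longrightarrow> dist x (axis c 1) < d \<Longrightarrow> \<bar>\<beta> x v - \<beta> (axis c 1) v\<bar> < e"
    using cont[of v, unfolded continuous_on_iff] X0(2) e by (metis dist_real_def)
  obtain d' where d': "d' > 0" "\<And>x. x \<in> X \<Longrightarrow> dist x 0 < d' \<Longrightarrow> \<bar>\<beta> x v - \<beta> 0 v\<bar> < e"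
    using cont[of v, unfolded continuous_on_iff] X0(1) e by (metis dist_real_def)
  obtain N0 :: nat where N0: "N0 > 1 / min d d'" using reals_Archimedean2 by blast
  have "\<And>k. k \<notin> S \<Longrightarrow> u $ k = 0" using \<open>u \<in> X\<close> by (simp add: X)
  then obtain N :: nat and A where "N > N0" and A: "A \<in> block_SL S"
    and move: "dist (SLZ_linear_act A (axis a (1 / N) + axis c 1)) u < r" "dist (SLZ_linear_act A (axis b (1 / N))) u < r"
    using block_SL_pair_transitive[OF abc _ r(1)] by metis
  define p q :: "real ^ 'n" where "p = axis a (1 / N) + axis c 1" and "q = axis b (1 / N)"
  have "1 / min d d' < N" using N0 \<open>N > N0\<close> by linarith
  then have N: "1 / N < min d d'" using d(1) d'(1) \<open>N > N0\<close>
    by (simp add: divide_less_eq mult.commute del: min_less_iff_conj)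
  have pq: "p \<in> X" "q \<in> X" using abc(2) by (auto simp: p_def q_def X axis_def)
  have "norm (axis k (1 / real N) :: real ^ 'n) = 1 / N" for k
  proof -
    have "axis k (1 / real N) = (1 / real N) *\<^sub>R axis k 1" by (simp add: vec_eq_iff axis_def)
    then show ?thesis by simp
  qed
  then have near: "\<bar>\<beta> p v - \<beta> (axis c 1) v\<bar> < e" "\<bar>\<beta> q v - \<beta> 0 v\<bar> < e"
    using N d(2)[OF pq(1)] d'(2)[OF pq(2)] by (auto simp: p_def q_def dist_norm)
  have "SLZ_linear_act A p \<in> X" "SLZ_linear_act A q \<in> X"
    using pq SLZ_linear_act_outside_block[OF A] by (auto simp: X)
  then have "SLZ_linear_act A p \<in> U" "SLZ_linear_act A q \<in> U"
    using r(2) move by (auto simp: p_def q_def)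
  then have "\<bar>\<beta> (SLZ_linear_act A p) (f A v) - \<beta> (SLZ_linear_act A q) (f A v)\<bar> \<le> e"
    using osc iso[OF A] v by auto
  \<comment> \<open>Invariance of the pairing carries the estimate in \<open>U\<close> back to the
    original points and the original vector.\<close>
  then have "\<bar>\<beta> p v - \<beta> q v\<bar> \<le> e" using equiv[OF A] pq by simp
  then show False using near e unfolding e_def by argo
qed

section \<open>Representations and the linear action\<close>

text \<open>Evaluating at \<open>h g v\<close> cancels the inverse in the dual action, so
  equivariance becomes invariance of the pairing.\<close>

lemma representation_isometry:
  assumes "representation G TG X act h \<alpha>" "g \<in> carrier G"
  shows "norm (h g v) = norm v"
    and "x \<in> topspace X \<Longrightarrow> \<alpha> (act g x) (h g v) = \<alpha> x v"
proof -
  have hg: "h g \<in> carrier Iso" using assms by (auto simp: representation_def hom_def)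
  then show "norm (h g v) = norm v" by (simp add: Iso_def)
  assume "x \<in> topspace X"
  then have "\<alpha> (act g x) (h g v) = \<alpha> x ((inv\<^bsub>Iso\<^esub> (h g) \<otimes>\<^bsub>Iso\<^esub> h g) v)"
    using assms by (simp add: representation_def dual_act_def Iso_def)
  then show "\<alpha> (act g x) (h g v) = \<alpha> x v"
    using hg by (simp add: group.l_inv[OF group_Iso]) (simp add: Iso_def)
qed

lemma representation_continuous:
  assumes "representation G TG X act h \<alpha>"
  shows "continuous_map X euclidean (\<lambda>x. \<alpha> x v)"
  using assms unfolding representation_def weak_star_topology_def
  by (simp add: continuous_on_strong_operator_topo_iff_coordinatewise)

lemma obtain_three_elements:
  assumes "card S \<ge> 3"
  obtains a b c where "distinct [a, b, c]" "{a, b, c} \<subseteq> S"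
proof -
  obtain T where "T \<subseteq> S" "card T = 3" using obtain_subset_with_card_n[OF assms] by metis
  then obtain a b c where "T = {a, b, c}" "a \<noteq> b" "b \<noteq> c" "a \<noteq> c" unfolding card_3_iff by blast
  then show thesis using \<open>T \<subseteq> S\<close> by (intro that[of a b c]) auto
qed

lemma SLZ_linear_not_Asplund_representable:
  assumes "CARD('n::finite) \<ge> 3"
  shows "\<not> Asplund_representable_on TYPE('v::banach) (SL :: (int ^ 'n ^ 'n) monoid) SLZ_topology
    (euclidean :: (real ^ 'n) topology) SLZ_linear_act"
proof
  assume "Asplund_representable_on TYPE('v) (SL :: (int ^ 'n ^ 'n) monoid) SLZ_topology
    (euclidean :: (real ^ 'n) topology) SLZ_linear_act"
  then obtain h and \<alpha> :: "real ^ 'n \<Rightarrow> ('v \<Rightarrow>\<^sub>L real)" where asp: "Asplund_space TYPE('v)"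
    and rep: "representation SL SLZ_topology euclidean SLZ_linear_act h \<alpha>"
    and emb: "embedding_map euclidean weak_star_topology \<alpha>"
    unfolding Asplund_representable_on_def proper_representation_def by blast
  obtain a b c :: 'n where abc: "distinct [a, b, c]" "{a, b, c} \<subseteq> UNIV"
    using obtain_three_elements[of "UNIV :: 'n set"] assms by blast
  have "\<alpha> (axis c 1) = \<alpha> 0"
  proof (rule Asplund_block_SL_collapse[OF asp abc, where X = UNIV and f = "\<lambda>A. h A"])
    show "continuous_on UNIV (\<lambda>x. \<alpha> x v)" for v
      using representation_continuous[OF rep] by simp
    fix A :: "int ^ 'n ^ 'n" and x v assume "A \<in> block_SL UNIV"
    then have "A \<in> carrier SL" by (simp add: block_SL_def)
    then show "norm (h A v) = norm v" "\<alpha> (SLZ_linear_act A x) (h A v) = \<alpha> x v"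
      using representation_isometry[OF rep] by simp_all
  qed simp
  moreover have "inj \<alpha>" using emb by (auto simp: embedding_map_def dest: homeomorphic_imp_injective_map)
  ultimately show False by (metis injD axis_eq_0_iff zero_neq_one)
qed

section \<open>The conjugation action\<close>

lemma map_matrix_of_int_SL:
  fixes A :: "int ^ 'n ^ 'n"
  assumes "A \<in> carrier SL"
  shows "(map_matrix of_int A :: real ^ 'n ^ 'n) \<in> carrier SL"
proof -
  have "det (map_matrix of_int A :: real ^ 'n ^ 'n) = of_int (det A)"
    by (simp add: det_def)
  then show ?thesis using assms by (simp add: SL_def)
qed

text \<open>Row \<open>l\<close> of \<open>A\<close> is that of the identity, so
  \<open>e_l^T A = e_l^T\<close> and \<open>A (I + x e_l^T) = (I + (A x) e_l^T) A\<close>. Working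
  with this commutation avoids computing the inverse.\<close>

lemma conjugation_shear:
  fixes A :: "int ^ 'n ^ 'n"
  assumes "A \<in> block_SL S" "l \<notin> S" "x $ l = 0"
  shows "conjugation_act SL (map_matrix of_int A) (shear x l) = shear (SLZ_linear_act A x) l"
proof -
  interpret group "SL :: (real ^ 'n ^ 'n) monoid" by (rule group_SL)
  let ?A = "map_matrix of_int A :: real ^ 'n ^ 'n" and ?y = "SLZ_linear_act A x"
  have row: "of_int (A $ l $ j) = (axis l 1 $ j :: real)" for j
    using assms(1,2) by (simp add: block_SL_def mat_def axis_def)
  have "(?A ** (\<chi> k. x $ k *s axis l 1)) $ i $ j = ((\<chi> k. ?y $ k *s axis l 1) ** ?A) $ i $ j" for i j
  proof -
    have "(?A ** (\<chi> k. x $ k *s axis l 1)) $ i $ j = ?y $ i * axis l 1 $ j"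
      by (simp add: matrix_matrix_mult_def SLZ_linear_act_def matrix_vector_mult_def sum_distrib_right mult.assoc)
    also have "\<dots> = (\<Sum>k\<in>UNIV. if k = l then ?y $ i * of_int (A $ l $ j) else 0)"
      by (simp add: row)
    also have "\<dots> = (\<Sum>k\<in>UNIV. ?y $ i * axis l 1 $ k * of_int (A $ k $ j))"
      by (intro sum.cong) (auto simp: axis_def)
    also have "\<dots> = ((\<chi> k. ?y $ k *s axis l 1) ** ?A) $ i $ j"
      by (simp add: matrix_matrix_mult_def)
    finally show ?thesis .
  qed
  moreover have "(mat 1 + B) ** C = C + B ** C" for B C :: "real ^ 'n ^ 'n"
  proof -
    have "(mat 1 + B) ** C = mat 1 ** C + B ** C"
      by (simp add: matrix_matrix_mult_def vec_eq_iff distrib_right sum.distrib)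
    then show ?thesis by simp
  qed
  ultimately have "?A ** shear x l = shear ?y l ** ?A"
    by (simp add: shear_def matrix_add_ldistrib vec_eq_iff)
  then have comm: "?A \<otimes>\<^bsub>SL\<^esub> shear x l = shear ?y l \<otimes>\<^bsub>SL\<^esub> ?A" by (simp add: SL_def)
  \<comment> \<open>This keeps the new shear in the group, where \<open>?A\<close> can be
    cancelled.\<close>
  have "?y $ l = 0" using SLZ_linear_act_outside_block[OF assms(1,2)] assms(3) by simp
  then have "shear ?y l \<in> carrier SL" by (simp add: SL_def det_shear)
  moreover have "?A \<in> carrier SL" using assms(1) by (intro map_matrix_of_int_SL) (simp add: block_SL_def)
  ultimately show ?thesis by (simp add: conjugation_act_def comm m_assoc)
qed

lemma SLR_conjugation_not_Asplund_representable:
  assumes "CARD('n::finite) \<ge> 4"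
  shows "\<not> Asplund_representable_on TYPE('v::banach) (SL :: (real ^ 'n ^ 'n) monoid) SLR_topology
    SLR_topology (conjugation_act SL)"
proof
  assume "Asplund_representable_on TYPE('v) (SL :: (real ^ 'n ^ 'n) monoid) SLR_topology
    SLR_topology (conjugation_act SL)"
  then obtain h and \<alpha> :: "real ^ 'n ^ 'n \<Rightarrow> ('v \<Rightarrow>\<^sub>L real)" where asp: "Asplund_space TYPE('v)"
    and rep: "representation SL SLR_topology SLR_topology (conjugation_act SL) h \<alpha>"
    and emb: "embedding_map SLR_topology weak_star_topology \<alpha>"
    unfolding Asplund_representable_on_def proper_representation_def by blast
  \<comment> \<open>An arbitrary index is set aside for the unipotent column; at least three others
    remain for the block.\<close>
  obtain l :: 'n where True by blast
  have "card (- {l}) \<ge> 3" using assms by (simp add: Compl_eq_Diff_UNIV)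
  then obtain a b c where abc: "distinct [a, b, c]" "{a, b, c} \<subseteq> - {l}"
    using obtain_three_elements by blast
  let ?X = "{x :: real ^ 'n. \<forall>k. k \<notin> - {l} \<longrightarrow> x $ k = 0}"
  have shear: "shear x l \<in> carrier SL" if "x \<in> ?X" for x
    using that by (simp add: SL_def det_shear)
  have "\<alpha> (shear (axis c 1) l) = \<alpha> (shear 0 l)"
  proof (rule Asplund_block_SL_collapse[OF asp abc,
        where X = ?X and \<beta> = "\<lambda>x. \<alpha> (shear x l)" and f = "\<lambda>A. h (map_matrix of_int A)"])
    show "continuous_on ?X (\<lambda>x. \<alpha> (shear x l) v)" for v
    proof (rule continuous_on_compose2[where f = "\<lambda>x. shear x l"])
      show "continuous_on (carrier SL) (\<lambda>z. \<alpha> z v)" using representation_continuous[OF rep] by simp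
      show "continuous_on ?X (\<lambda>x. shear x l)"
        unfolding shear_def vector_scalar_mult_def by (intro continuous_intros continuous_on_vec_lambda)
      show "(\<lambda>x. shear x l) ` ?X \<subseteq> carrier SL" using shear by blast
    qed
    fix A :: "int ^ 'n ^ 'n" and x :: "real ^ 'n" and v assume A: "A \<in> block_SL (- {l})"
    then have SL: "map_matrix of_int A \<in> carrier (SL :: (real ^ 'n ^ 'n) monoid)"
      by (intro map_matrix_of_int_SL) (simp add: block_SL_def)
    show "norm (h (map_matrix of_int A) v) = norm v"
      by (rule representation_isometry(1)[OF rep SL])
    assume "x \<in> ?X"
    then show "\<alpha> (shear (SLZ_linear_act A x) l) (h (map_matrix of_int A) v) = \<alpha> (shear x l) v"
      using representation_isometry(2)[OF rep SL, of "shear x l" v] shear conjugation_shear[OF A, of l x] by simp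
  qed simp
  moreover have "inj_on \<alpha> (carrier SL)" using emb by (auto simp: embedding_map_def dest: homeomorphic_imp_injective_map)
  moreover have "shear (axis c 1) l \<in> carrier (SL :: (real ^ 'n ^ 'n) monoid)"
      "shear 0 l \<in> carrier (SL :: (real ^ 'n ^ 'n) monoid)"
    using abc by (auto intro!: shear simp: axis_def)
  ultimately have "shear (axis c 1) l = (shear 0 l :: real ^ 'n ^ 'n)" by (meson inj_onD)
  \<comment> \<open>At this position the two matrices differ by 1.\<close>
  then have "shear (axis c 1) l $ c $ l = (shear 0 l :: real ^ 'n ^ 'n) $ c $ l" by simp
  then show False by (simp add: shear_def)
qed

theorem theorem3p10:
  shows "(CARD('n::finite) \<ge> 3 \<longrightarrow>
            \<not> Asplund_representable_on TYPE('v::banach)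
                (SL :: (int ^ 'n ^ 'n) monoid) SLZ_topology
                (euclidean :: (real ^ 'n) topology) SLZ_linear_act)
       \<and> (CARD('n) \<ge> 4 \<longrightarrow>
            \<not> Asplund_representable_on TYPE('v)
                (SL :: (real ^ 'n ^ 'n) monoid) SLR_topology
                SLR_topology (conjugation_act SL))"
  using SLZ_linear_not_Asplund_representable SLR_conjugation_not_Asplund_representable by blast

end
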